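(* Let $(\boldsymbol{x},\boldsymbol{n},\boldsymbol{s}):U\to\mathbb{R}^3\times\Delta$ be a framed surface with basic invariants $a_i,b_i,e_i,f_i,g_i$ ($i=1,2$). Then $(\boldsymbol{x},\boldsymbol{n},\boldsymbol{s})$ is an $(\boldsymbol{n},\overline{\boldsymbol{t}})$-Bertrand framed surface if and only if there exist smooth functions $\lambda,\widetilde\theta:U\to\mathbb{R}$ with $\lambda\not\equiv0$ such that $$\begin{pmatrix} a_1(u,v)+\lambda(u,v)e_1(u,v) & b_1(u,v)+\lambda(u,v)f_1(u,v)\\ a_2(u,v)+\lambda(u,v)e_2(u,v) & b_2(u,v)+\lambda(u,v)f_2(u,v)\end{pmatrix}\begin{pmatrix}-\cos\widetilde\theta(u,v)\\ \sin\widetilde\theta(u,v)\end{pmatrix}=\begin{pmatrix}0\\0\end{pmatrix}$$ for all $(u,v)\in U$.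
   Context: All maps are $C^\infty$. $U\subset\mathbb{R}^2$ is a simply connected domain with coordinates $(u,v)$, $S^2$ is the unit sphere in $\mathbb{R}^3$, and $\Delta=\{(\boldsymbol{a},\boldsymbol{b})\in S^2\times S^2 : \boldsymbol{a}\cdot\boldsymbol{b}=0\}$. A framed surface is a smooth map $(\boldsymbol{x},\boldsymbol{n},\boldsymbol{s}):U\to\mathbb{R}^3\times\Delta$ with $\boldsymbol{x}_u\cdot\boldsymbol{n}=\boldsymbol{x}_v\cdot\boldsymbol{n}=0$ on $U$. Put $\boldsymbol{t}=\boldsymbol{n}\times\boldsymbol{s}$. Its basic invariants are the smooth functions $a_i,b_i,e_i,f_i,g_i:U\to\mathbb{R}$ ($i=1,2$) determined by $\boldsymbol{x}_u=a_1\boldsymbol{s}+b_1\boldsymbol{t}$, $\boldsymbol{n}_u=e_1\boldsymbol{s}+f_1\boldsymbol{t}$, $\boldsymbol{s}_u=-e_1\boldsymbol{n}+g_1\boldsymbol{t}$, $\boldsymbol{t}_u=-f_1\boldsymbol{n}-g_1\boldsymbol{s}$, and the same equations with $\partial_v$ in place of $\partial_u$ and index $2$ in place of $1$. For a smooth $\lambda:U\to\mathbb{R}$, $\lambda\not\equiv0$ means that $\{(u,v)\in U:\lambda(u,v)\neq0\}$ is dense in $U$. Two framed surfaces $(\boldsymbol{x},\boldsymbol{n},\boldsymbol{s}),(\overline{\boldsymbol{x}},\overline{\boldsymbol{n}},\overline{\boldsymbol{s}}):U\to\mathbb{R}^3\times\Delta$ (with $\overline{\boldsymbol{t}}=\overline{\boldsymbol{n}}\times\overline{\boldsymbol{s}}$)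 are $(\boldsymbol{v},\overline{\boldsymbol{w}})$-mates, where each of $\boldsymbol{v},\boldsymbol{w}$ is one of $\boldsymbol{n},\boldsymbol{s},\boldsymbol{t}$, if there is a smooth $\lambda:U\to\mathbb{R}$ with $\lambda\not\equiv0$ such that $\overline{\boldsymbol{x}}=\boldsymbol{x}+\lambda\boldsymbol{v}$ and $\boldsymbol{v}=\overline{\boldsymbol{w}}$ on $U$. $(\boldsymbol{x},\boldsymbol{n},\boldsymbol{s})$ is a $(\boldsymbol{v},\overline{\boldsymbol{w}})$-Bertrand framed surface if there is a framed surface $(\overline{\boldsymbol{x}},\overline{\boldsymbol{n}},\overline{\boldsymbol{s}}):U\to\mathbb{R}^3\times\Delta$ such that the two are $(\boldsymbol{v},\overline{\boldsymbol{w}})$-mates. *)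

theory Defs
  imports "HOL-Analysis.Analysis"
begin

text \<open>
  Smoothness on an open set \<open>S\<close>: all iterated directional derivatives exist and are continuous.
  Total derivatives are used (no \<open>within S\<close>), so the notion is only meant for open \<open>S\<close>, where it
  does not depend on the values of the function outside \<open>S\<close>.
\<close>

primrec higher_differentiable_on ::
  "'a::real_normed_vector set \<Rightarrow> ('a \<Rightarrow> 'b::real_normed_vector) \<Rightarrow> nat \<Rightarrow> bool" where
  "higher_differentiable_on S f 0 \<longleftrightarrow> continuous_on S f"
| "higher_differentiable_on S f (Suc k) \<longleftrightarrow>
     (\<forall>p\<in>S. f differentiable (at p)) \<and>
     (\<forall>w. higher_differentiable_on S (\<lambda>p. frechet_derivative f (at p) w) k)"

definition smooth_on :: "'a::real_normed_vector set \<Rightarrow> ('a \<Rightarrow> 'b::real_normed_vector) \<Rightarrow> bool" where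
  "smooth_on S f \<longleftrightarrow> (\<forall>k. higher_differentiable_on S f k)"

text \<open>Points of the plane are pairs \<open>(u, v)\<close>.\<close>

definition partial_u :: "(real \<times> real \<Rightarrow> 'b::real_normed_vector) \<Rightarrow> real \<times> real \<Rightarrow> 'b" where
  "partial_u f p = frechet_derivative f (at p) (1, 0)"

definition partial_v :: "(real \<times> real \<Rightarrow> 'b::real_normed_vector) \<Rightarrow> real \<times> real \<Rightarrow> 'b" where
  "partial_v f p = frechet_derivative f (at p) (0, 1)"

definition Delta :: "((real^3) \<times> (real^3)) set" where
  "Delta = {(a, b). a \<in> sphere 0 1 \<and> b \<in> sphere 0 1 \<and> a \<bullet> b = 0}"

definition framed_surface ::
  "(real \<times> real) set \<Rightarrow> (real \<times> real \<Rightarrow> real^3) \<Rightarrow> (real \<times> real \<Rightarrow> real^3) \<Rightarrow>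
   (real \<times> real \<Rightarrow> real^3) \<Rightarrow> bool" where
  "framed_surface U x n s \<longleftrightarrow>
     smooth_on U x \<and> smooth_on U n \<and> smooth_on U s \<and>
     (\<forall>p\<in>U. (n p, s p) \<in> Delta) \<and>
     (\<forall>p\<in>U. partial_u x p \<bullet> n p = 0 \<and> partial_v x p \<bullet> n p = 0)"

definition frame_t ::
  "(real \<times> real \<Rightarrow> real^3) \<Rightarrow> (real \<times> real \<Rightarrow> real^3) \<Rightarrow> real \<times> real \<Rightarrow> real^3" where
  "frame_t n s = (\<lambda>p. cross3 (n p) (s p))"

definition basic_invariants ::
  "(real \<times> real) set \<Rightarrow> (real \<times> real \<Rightarrow> real^3) \<Rightarrow> (real \<times> real \<Rightarrow> real^3) \<Rightarrow>
   (real \<times> real \<Rightarrow> real^3) \<Rightarrow>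
   (real \<times> real \<Rightarrow> real) \<Rightarrow> (real \<times> real \<Rightarrow> real) \<Rightarrow> (real \<times> real \<Rightarrow> real) \<Rightarrow>
   (real \<times> real \<Rightarrow> real) \<Rightarrow> (real \<times> real \<Rightarrow> real) \<Rightarrow>
   (real \<times> real \<Rightarrow> real) \<Rightarrow> (real \<times> real \<Rightarrow> real) \<Rightarrow> (real \<times> real \<Rightarrow> real) \<Rightarrow>
   (real \<times> real \<Rightarrow> real) \<Rightarrow> (real \<times> real \<Rightarrow> real) \<Rightarrow> bool" where
  "basic_invariants U x n s a1 b1 e1 f1 g1 a2 b2 e2 f2 g2 \<longleftrightarrow>
     smooth_on U a1 \<and> smooth_on U b1 \<and> smooth_on U e1 \<and> smooth_on U f1 \<and> smooth_on U g1 \<and>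
     smooth_on U a2 \<and> smooth_on U b2 \<and> smooth_on U e2 \<and> smooth_on U f2 \<and> smooth_on U g2 \<and>
     (let t = frame_t n s in \<forall>p\<in>U.
        partial_u x p = a1 p *\<^sub>R s p + b1 p *\<^sub>R t p \<and>
        partial_u n p = e1 p *\<^sub>R s p + f1 p *\<^sub>R t p \<and>
        partial_u s p = - e1 p *\<^sub>R n p + g1 p *\<^sub>R t p \<and>
        partial_u t p = - f1 p *\<^sub>R n p - g1 p *\<^sub>R s p \<and>
        partial_v x p = a2 p *\<^sub>R s p + b2 p *\<^sub>R t p \<and>
        partial_v n p = e2 p *\<^sub>R s p + f2 p *\<^sub>R t p \<and>
        partial_v s p = - e2 p *\<^sub>R n p + g2 p *\<^sub>R t p \<and>
        partial_v t p = - f2 p *\<^sub>R n p - g2 p *\<^sub>R s p)"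

text \<open>
  The convention for \<open>\<lambda> \<not>\<equiv> 0\<close>: the set where \<open>\<lambda>\<close> does not vanish is dense in \<open>U\<close>. This is stronger than
  \<open>\<lambda>\<close> not being the zero function.
\<close>

definition densely_nonzero_on :: "(real \<times> real) set \<Rightarrow> (real \<times> real \<Rightarrow> real) \<Rightarrow> bool" where
  "densely_nonzero_on U l \<longleftrightarrow> U \<subseteq> closure {p \<in> U. l p \<noteq> 0}"

datatype frame_leg = Leg_n | Leg_s | Leg_t

fun frame_vector ::
  "frame_leg \<Rightarrow> (real \<times> real \<Rightarrow> real^3) \<Rightarrow> (real \<times> real \<Rightarrow> real^3) \<Rightarrow> real \<times> real \<Rightarrow> real^3" where
  "frame_vector Leg_n n s = n"
| "frame_vector Leg_s n s = s"
| "frame_vector Leg_t n s = frame_t n s"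

text \<open>
  In \<open>mates U V W\<close> and \<open>Bertrand_framed_surface U V W\<close>, leg \<open>V\<close> is taken in the frame of the given
  surface and leg \<open>W\<close> in the frame of its mate.
\<close>

definition mates ::
  "(real \<times> real) set \<Rightarrow> frame_leg \<Rightarrow> frame_leg \<Rightarrow>
   (real \<times> real \<Rightarrow> real^3) \<Rightarrow> (real \<times> real \<Rightarrow> real^3) \<Rightarrow> (real \<times> real \<Rightarrow> real^3) \<Rightarrow>
   (real \<times> real \<Rightarrow> real^3) \<Rightarrow> (real \<times> real \<Rightarrow> real^3) \<Rightarrow> (real \<times> real \<Rightarrow> real^3) \<Rightarrow> bool" where
  "mates U V W x n s x' n' s' \<longleftrightarrow>
     framed_surface U x n s \<and> framed_surface U x' n' s' \<and>
     (\<exists>l. smooth_on U l \<and> densely_nonzero_on U l \<and>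
        (\<forall>p\<in>U. x' p = x p + l p *\<^sub>R frame_vector V n s p \<and>
               frame_vector V n s p = frame_vector W n' s' p))"

definition Bertrand_framed_surface ::
  "(real \<times> real) set \<Rightarrow> frame_leg \<Rightarrow> frame_leg \<Rightarrow>
   (real \<times> real \<Rightarrow> real^3) \<Rightarrow> (real \<times> real \<Rightarrow> real^3) \<Rightarrow> (real \<times> real \<Rightarrow> real^3) \<Rightarrow> bool" where
  "Bertrand_framed_surface U V W x n s \<longleftrightarrow>
     (\<exists>x' n' s'. framed_surface U x' n' s' \<and> mates U V W x n s x' n' s')"

end

theory Submission
  imports Defs
begin

text \<open>
  Write \<open>t\<close> for the third leg of the given frame, and \<open>y = x + l n\<close> for a candidate mate with frame
  \<open>(m, r)\<close>, \<open>m\<close> being its unit normal. The condition that \<open>n\<close> is the third leg of the new frame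
  puts \<open>m\<close> in the plane spanned by \<open>s\<close> and \<open>t\<close>, so \<open>m\<close> is a unit vector of the form
  \<open>- cos \<theta> s + sin \<theta> t\<close>. Since \<open>m\<close> is orthogonal to \<open>n\<close>, the derivative of \<open>l\<close> drops out of
  \<open>dy \<bullet> m = (dx + l dn) \<bullet> m\<close>; expanding \<open>dx\<close> and \<open>dn\<close> in the basic invariants turns the two
  tangency conditions for \<open>y\<close> into the two rows of the linear system
  (\<open>normal_offset_partials\<close>). Conversely, a solution \<open>\<theta>\<close> defines \<open>m\<close> by the formula above, and
  \<open>r = - sin \<theta> s - cos \<theta> t\<close> is then the only vector orthogonal to \<open>m\<close> with \<open>m \<times> r = n\<close>.

  The analytic content is that \<open>\<theta>\<close> can be chosen smooth on all of \<open>U\<close>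
  (\<open>smooth_polar_angle\<close>). As \<open>U\<close> is simply connected, the map \<open>p \<mapsto> (- m \<bullet> s, m \<bullet> t)\<close> into the unit
  circle has a continuous logarithm, hence a continuous angle. A continuous angle of smooth
  coordinates is itself smooth, because its differential must be \<open>c dd - d dc\<close> for
  \<open>(c, d) = (cos \<theta>, sin \<theta>)\<close>, which is again a smooth expression.
\<close>

section \<open>Calculus of smooth functions on open sets\<close>

lemma higher_differentiable_on_cong:
  assumes "open S" and "\<And>p. p \<in> S \<Longrightarrow> f p = g p" and "higher_differentiable_on S f k"
  shows "higher_differentiable_on S g k"
  using assms(2,3)
proof (induction k arbitrary: f g)
  case 0
  then show ?case
    by (metis continuous_on_cong higher_differentiable_on.simps(1))
next
  case (Suc k)
  have der: "(g has_derivative frechet_derivative f (at p)) (at p)" if "p \<in> S" for p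
  proof (rule has_derivative_transform_within_open[OF _ \<open>open S\<close> that])
    show "(f has_derivative frechet_derivative f (at p)) (at p)"
      using Suc.prems(2) that by (simp add: frechet_derivative_works[symmetric])
  qed (use Suc.prems(1) in auto)
  have eq: "frechet_derivative f (at p) w = frechet_derivative g (at p) w" if "p \<in> S" for p w
    using frechet_derivative_at[OF der[OF that]] by simp
  have "higher_differentiable_on S (\<lambda>p. frechet_derivative g (at p) w) k" for w
    by (rule Suc.IH[of "\<lambda>p. frechet_derivative f (at p) w"]) (use eq Suc.prems(2) in auto)
  then show ?case
    using der by (auto simp: differentiable_def)
qed

text \<open>
  The definition speaks about the chosen derivative \<^const>\<open>frechet_derivative\<close>; here any explicit formula
  for the derivative may be used, which is what lets the usual differentiation rules drive
  inductions on the order of differentiability.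
\<close>

lemma higher_differentiable_on_SucI:
  assumes "open S"
    and "\<And>p. p \<in> S \<Longrightarrow> (f has_derivative D p) (at p)"
    and "\<And>w. higher_differentiable_on S (\<lambda>p. D p w) k"
  shows "higher_differentiable_on S f (Suc k)"
proof -
  have "higher_differentiable_on S (\<lambda>p. frechet_derivative f (at p) w) k" for w
    by (rule higher_differentiable_on_cong[OF \<open>open S\<close> _ assms(3)[of w]])
      (metis assms(2) frechet_derivative_at)
  then show ?thesis
    using assms(2) by (auto simp: differentiable_def)
qed

text \<open>
  The definition asks for continuity at order \<open>0\<close> only, so that the orders are nested rests on
  differentiable functions being continuous.
\<close>

lemma higher_differentiable_on_SucD:
  "higher_differentiable_on S f (Suc k) \<Longrightarrow> higher_differentiable_on S f k"
proof (induction k arbitrary: f)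
  case 0
  then show ?case
    by (auto intro!: differentiable_imp_continuous_on differentiable_at_imp_differentiable_on)
next
  case (Suc k)
  have "higher_differentiable_on S (\<lambda>p. frechet_derivative f (at p) w) k" for w
    by (rule Suc.IH) (use Suc.prems in simp)
  then show ?case
    using Suc.prems by simp
qed

lemma higher_differentiable_on_has_derivative:
  "higher_differentiable_on S f (Suc k) \<Longrightarrow> p \<in> S \<Longrightarrow>
    (f has_derivative frechet_derivative f (at p)) (at p)"
  by (simp add: frechet_derivative_works[symmetric])

lemma higher_differentiable_on_add:
  assumes "open S" "higher_differentiable_on S f k" "higher_differentiable_on S g k"
  shows "higher_differentiable_on S (\<lambda>p. f p + g p) k"
  using assms(2,3)
proof (induction k arbitrary: f g)
  case 0
  then show ?case by (auto intro: continuous_on_add)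
next
  case (Suc k)
  show ?case
    by (rule higher_differentiable_on_SucI[OF \<open>open S\<close>
          has_derivative_add[OF higher_differentiable_on_has_derivative[OF Suc.prems(1)]
            higher_differentiable_on_has_derivative[OF Suc.prems(2)]]])
      (use Suc in auto)
qed

lemma (in bounded_linear) higher_differentiable_on_compose:
  assumes "open S" "higher_differentiable_on S g k"
  shows "higher_differentiable_on S (\<lambda>p. f (g p)) k"
  using assms(2)
proof (induction k arbitrary: g)
  case 0
  then show ?case by (auto intro: continuous_on)
next
  case (Suc k)
  show ?case
    by (rule higher_differentiable_on_SucI[OF \<open>open S\<close>
          has_derivative[OF higher_differentiable_on_has_derivative[OF Suc.prems]]])
      (use Suc in auto)
qed

text \<open>
  One instance of the Leibniz rule for an arbitrary bounded bilinear operation covers products,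
  scalar multiples, inner products and cross products. The induction step needs the factors
  themselves at order \<open>k\<close> next to their derivatives at order \<open>k\<close>.
\<close>

lemma (in bounded_bilinear) higher_differentiable_on_prod:
  assumes "open S" "higher_differentiable_on S f k" "higher_differentiable_on S g k"
  shows "higher_differentiable_on S (\<lambda>p. prod (f p) (g p)) k"
  using assms(2,3)
proof (induction k arbitrary: f g)
  case 0
  then show ?case by (auto intro: continuous_on)
next
  case (Suc k)
  note low = Suc.prems[THEN higher_differentiable_on_SucD]
  show ?case
    by (rule higher_differentiable_on_SucI[OF \<open>open S\<close>
          FDERIV[OF higher_differentiable_on_has_derivative[OF Suc.prems(1)]
            higher_differentiable_on_has_derivative[OF Suc.prems(2)]]])
      (use Suc low in \<open>auto intro!: higher_differentiable_on_add[OF \<open>open S\<close>]\<close>)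
qed

lemma smooth_on_has_derivative:
  "smooth_on S f \<Longrightarrow> p \<in> S \<Longrightarrow> (f has_derivative frechet_derivative f (at p)) (at p)"
  by (rule higher_differentiable_on_has_derivative[where k = 0]) (simp_all only: smooth_on_def)

lemma smooth_on_continuous_on: "smooth_on S f \<Longrightarrow> continuous_on S f"
  unfolding smooth_on_def by (drule spec[of _ 0]) simp

lemma smooth_on_derivative:
  "smooth_on S f \<Longrightarrow> smooth_on S (\<lambda>p. frechet_derivative f (at p) w)"
  unfolding smooth_on_def
proof
  fix k
  assume "\<forall>k. higher_differentiable_on S f k"
  then have "higher_differentiable_on S f (Suc k)" ..
  then show "higher_differentiable_on S (\<lambda>p. frechet_derivative f (at p) w) k"
    by simp
qed

text \<open>Used to recognise smoothness of a function known only through its derivative.\<close>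

lemma smooth_onI_derivative:
  assumes "open S"
    and "\<And>p. p \<in> S \<Longrightarrow> (f has_derivative D p) (at p)"
    and "\<And>w. smooth_on S (\<lambda>p. D p w)"
  shows "smooth_on S f"
  unfolding smooth_on_def
proof
  fix k
  have "higher_differentiable_on S f (Suc k)"
  proof (rule higher_differentiable_on_SucI[OF assms(1,2)])
    show "higher_differentiable_on S (\<lambda>p. D p w) k" for w
      using assms(3)[of w] unfolding smooth_on_def by blast
  qed
  then show "higher_differentiable_on S f k"
    by (rule higher_differentiable_on_SucD)
qed

lemma smooth_on_add:
  "open S \<Longrightarrow> smooth_on S f \<Longrightarrow> smooth_on S g \<Longrightarrow> smooth_on S (\<lambda>p. f p + g p)"
  by (simp only: smooth_on_def higher_differentiable_on_add simp_thms)

lemma (in bounded_linear) smooth_on_compose: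
  "open S \<Longrightarrow> smooth_on S g \<Longrightarrow> smooth_on S (\<lambda>p. f (g p))"
  by (simp only: smooth_on_def higher_differentiable_on_compose simp_thms)

lemma (in bounded_bilinear) smooth_on_prod:
  "open S \<Longrightarrow> smooth_on S f \<Longrightarrow> smooth_on S g \<Longrightarrow> smooth_on S (\<lambda>p. prod (f p) (g p))"
  by (simp only: smooth_on_def higher_differentiable_on_prod simp_thms)

lemmas smooth_on_minus = bounded_linear.smooth_on_compose[OF
    bounded_linear_minus[OF bounded_linear_ident]]
lemmas smooth_on_mult = bounded_bilinear.smooth_on_prod[OF bounded_bilinear_mult]
lemmas smooth_on_scaleR = bounded_bilinear.smooth_on_prod[OF bounded_bilinear_scaleR]
lemmas smooth_on_inner = bounded_bilinear.smooth_on_prod[OF bounded_bilinear_inner]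
lemmas smooth_on_cross3 =
  bounded_bilinear.smooth_on_prod[OF bilinear_cross[unfolded bilinear_conv_bounded_bilinear]]

text \<open>
  The derivatives of \<open>cos \<circ> h\<close> and \<open>sin \<circ> h\<close> involve each other, so the order of differentiability
  of both has to be raised in a single induction.
\<close>

lemma smooth_on_cos_sin:
  fixes h :: "'a::real_normed_vector \<Rightarrow> real"
  assumes "open S" "smooth_on S h"
  shows "smooth_on S (\<lambda>p. cos (h p))" and "smooth_on S (\<lambda>p. sin (h p))"
proof -
  have "higher_differentiable_on S (\<lambda>p. cos (h p)) k \<and> higher_differentiable_on S (\<lambda>p. sin (h p)) k" for k
  proof (induction k)
    case 0
    show ?case
      using smooth_on_continuous_on[OF assms(2)] by (simp add: continuous_on_cos continuous_on_sin)
  next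
    case (Suc k)
    have D: "higher_differentiable_on S (\<lambda>p. frechet_derivative h (at p) w) k" for w
      using smooth_on_derivative[OF assms(2)] by (simp add: smooth_on_def)
    note prod = bounded_bilinear.higher_differentiable_on_prod[OF bounded_bilinear_mult \<open>open S\<close>]
    note neg = bounded_linear.higher_differentiable_on_compose
      [OF bounded_linear_minus[OF bounded_linear_ident] \<open>open S\<close>]
    have "higher_differentiable_on S (\<lambda>p. cos (h p)) (Suc k)"
      by (rule higher_differentiable_on_SucI[OF \<open>open S\<close>,
            where D = "\<lambda>p w. - sin (h p) * frechet_derivative h (at p) w"])
        (use Suc D in \<open>auto intro!: prod neg derivative_eq_intros
          smooth_on_has_derivative[OF assms(2)]\<close>)
    moreover have "higher_differentiable_on S (\<lambda>p. sin (h p)) (Suc k)"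
      by (rule higher_differentiable_on_SucI[OF \<open>open S\<close>,
            where D = "\<lambda>p w. cos (h p) * frechet_derivative h (at p) w"])
        (use Suc D in \<open>auto intro!: prod derivative_eq_intros
          smooth_on_has_derivative[OF assms(2)]\<close>)
    ultimately show ?case ..
  qed
  then show "smooth_on S (\<lambda>p. cos (h p))" and "smooth_on S (\<lambda>p. sin (h p))"
    by (auto simp: smooth_on_def)
qed

section \<open>Smooth angle functions\<close>

text \<open>
  Near a point \<open>p\<close> the angle \<open>h\<close> varies by less than \<open>\<pi>/2\<close>, so it can be recovered from its sine and
  cosine as \<open>h q = h p + arcsin (sin (h q - h p))\<close>, where the addition theorem expresses
  \<open>sin (h q - h p)\<close> through \<open>c\<close> and \<open>d\<close>. As \<open>arcsin\<close> has derivative \<open>1\<close> at \<open>0\<close>, this gives the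
  differential \<open>c dd - d dc\<close>.
\<close>

lemma smooth_on_angle:
  fixes c d h :: "'a::real_normed_vector \<Rightarrow> real"
  assumes "open S" "smooth_on S c" "smooth_on S d" "continuous_on S h"
    and cos: "\<And>p. p \<in> S \<Longrightarrow> cos (h p) = c p" and sin: "\<And>p. p \<in> S \<Longrightarrow> sin (h p) = d p"
  shows "smooth_on S h"
proof (rule smooth_onI_derivative[OF \<open>open S\<close>])
  let ?D = "\<lambda>p w. c p * frechet_derivative d (at p) w + - (d p * frechet_derivative c (at p) w)"
  show "(h has_derivative ?D p) (at p)" if p: "p \<in> S" for p
  proof -
    let ?g = "\<lambda>q. h p + arcsin (d q * c p - c q * d p)"
    have g: "(?g has_derivative ?D p) (at p)"
      by (auto intro!: derivative_eq_intros smooth_on_has_derivative[OF assms(2) p]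
          smooth_on_has_derivative[OF assms(3) p] simp: algebra_simps)
    have "isCont h p"
      using assms(1,4) p by (simp add: continuous_on_eq_continuous_at)
    then have "eventually (\<lambda>q. dist (h q) (h p) < pi/2) (at p)"
      unfolding isCont_def by (rule tendstoD) simp
    moreover have "eventually (\<lambda>q. q \<in> S) (at p)"
      using assms(1) p by (rule eventually_at_in_open')
    ultimately have "eventually (\<lambda>q. ?g q = h q) (at p)"
    proof eventually_elim
      case (elim q)
      have "d q * c p - c q * d p = sin (h q - h p)"
        using elim p by (simp add: sin_diff cos sin)
      moreover have "arcsin (sin (h q - h p)) = h q - h p"
        using elim(1) unfolding dist_real_def by (intro arcsin_sin) linarith+
      ultimately show ?case by simp
    qed
    then show ?thesis
      using has_derivative_transform_eventually[OF g] by simp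
  qed
  show "smooth_on S (\<lambda>p. ?D p w)" for w
    by (intro smooth_on_add smooth_on_minus smooth_on_mult smooth_on_derivative assms)
qed

text \<open>
  Simple connectedness enters here: the nowhere vanishing function \<open>c + i d\<close> has a continuous
  logarithm, whose real part vanishes and whose imaginary part is the angle.
\<close>

lemma smooth_polar_angle:
  fixes c d :: "'a::real_normed_vector \<Rightarrow> real"
  assumes "open S" "simply_connected S" "smooth_on S c" "smooth_on S d"
    and unit: "\<And>p. p \<in> S \<Longrightarrow> (c p)\<^sup>2 + (d p)\<^sup>2 = 1"
  obtains h where "smooth_on S h" "\<And>p. p \<in> S \<Longrightarrow> c p = cos (h p)" "\<And>p. p \<in> S \<Longrightarrow> d p = sin (h p)"
proof -
  have "continuous_on S (\<lambda>p. Complex (c p) (d p))"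
    unfolding Complex_eq
    by (intro continuous_intros smooth_on_continuous_on assms)
  moreover have "Complex (c p) (d p) \<noteq> 0" if "p \<in> S" for p
    using unit[OF that] by (auto simp: complex_eq_iff)
  ultimately obtain g
    where g: "continuous_on S g" "\<And>p. p \<in> S \<Longrightarrow> Complex (c p) (d p) = exp (g p)"
    by (rule continuous_logarithm_on_simply_connected
        [OF _ assms(2) open_imp_locally_path_connected[OF assms(1)]]) auto
  have "exp (Re (g p)) = 1" if "p \<in> S" for p
    using unit[OF that] g(2)[OF that] by (metis cmod_def complex.sel norm_exp_eq_Re real_sqrt_one)
  then have cs: "c p = cos (Im (g p))" "d p = sin (Im (g p))" if "p \<in> S" for p
    using g(2)[OF that] that by (auto simp: complex_eq_iff Re_exp Im_exp)
  show thesis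
  proof (rule that[of "\<lambda>p. Im (g p)"])
    show "smooth_on S (\<lambda>p. Im (g p))"
      by (rule smooth_on_angle[OF assms(1,3,4)]) (use g(1) cs in \<open>auto intro!: continuous_intros\<close>)
  qed (use cs in auto)
qed

section \<open>Orthonormal frames and normal offsets\<close>

lemma Delta_frame:
  assumes "(a, b) \<in> Delta"
  shows "a \<bullet> a = 1" "b \<bullet> b = 1" "a \<bullet> b = 0" "b \<bullet> a = 0"
    "cross3 a b \<bullet> a = 0" "cross3 a b \<bullet> b = 0" "a \<bullet> cross3 a b = 0" "b \<bullet> cross3 a b = 0"
    "cross3 a b \<bullet> cross3 a b = 1" "cross3 b (cross3 a b) = a"
proof -
  show 1: "a \<bullet> a = 1" "b \<bullet> b = 1" "a \<bullet> b = 0" "b \<bullet> a = 0"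
    using assms by (auto simp: Delta_def norm_eq_1 inner_commute)
  show "cross3 a b \<bullet> a = 0" "cross3 a b \<bullet> b = 0" "a \<bullet> cross3 a b = 0" "b \<bullet> cross3 a b = 0"
    by (simp_all add: dot_cross_self)
  show "cross3 a b \<bullet> cross3 a b = 1"
    using 1 by (simp add: dot_cross)
  show "cross3 b (cross3 a b) = a"
    using 1 by (simp add: Lagrange)
qed

lemma cross3_linear_combinations:
  "cross3 (a *\<^sub>R x + b *\<^sub>R y) (c *\<^sub>R x + d *\<^sub>R y) = (a * d - b * c) *\<^sub>R cross3 x y"
  using cross_skew[of y x]
  by (simp add: cross_add_left cross_add_right cross_mult_left cross_mult_right scaleR_left_diff_distrib
      mult.commute)

text \<open>
  This is Parseval's identity for a vector \<open>m\<close> orthogonal to the first leg. The vector \<open>m \<times> b\<close> is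
  parallel to \<open>a\<close>, as both \<open>m\<close> and \<open>b\<close> are orthogonal to \<open>a\<close>; hence its length is, up to sign, the
  triple product \<open>m \<bullet> (a \<times> b)\<close>, and the claim becomes \<open>\<bar>m \<times> b\<bar>\<^sup>2 + (m \<bullet> b)\<^sup>2 = \<bar>m\<bar>\<^sup>2\<close>.
\<close>

lemma Delta_coordinates_unit:
  assumes "(a, b) \<in> Delta" "m \<bullet> a = 0"
  shows "(m \<bullet> b)\<^sup>2 + (m \<bullet> cross3 a b)\<^sup>2 = m \<bullet> m"
proof -
  let ?w = "cross3 m b"
  have "cross3 a ?w = 0"
    using Delta_frame(3)[OF assms(1)] assms(2) by (simp add: Lagrange inner_commute)
  then have "(a \<bullet> ?w)\<^sup>2 = ?w \<bullet> ?w"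
    using norm_cross_dot[of a ?w] Delta_frame(1)[OF assms(1)]
    by (simp add: power_mult_distrib power2_norm_eq_inner)
  moreover have "?w \<bullet> ?w + (m \<bullet> b)\<^sup>2 = m \<bullet> m"
    using norm_cross_dot[of m b] Delta_frame(2)[OF assms(1)]
    by (simp add: power_mult_distrib power2_norm_eq_inner)
  moreover have "m \<bullet> cross3 a b = - (a \<bullet> ?w)"
    by (simp add: cross3_simps)
  ultimately show ?thesis
    by simp
qed

text \<open>
  By the product rule the derivative of \<open>l n\<close> is \<open>l dn + dl n\<close>, and the second summand is
  orthogonal to \<open>m\<close>.
\<close>

lemma normal_offset_derivative:
  assumes "open U" "p \<in> U" "smooth_on U x" "smooth_on U n" "smooth_on U l"
    and "\<And>q. q \<in> U \<Longrightarrow> y q = x q + l q *\<^sub>R n q" and "n p \<bullet> m = 0"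
  shows "frechet_derivative y (at p) w \<bullet> m
    = (frechet_derivative x (at p) w + l p *\<^sub>R frechet_derivative n (at p) w) \<bullet> m"
proof -
  let ?D = "\<lambda>w. frechet_derivative x (at p) w + (l p *\<^sub>R frechet_derivative n (at p) w
      + frechet_derivative l (at p) w *\<^sub>R n p)"
  have "((\<lambda>q. x q + l q *\<^sub>R n q) has_derivative ?D) (at p)"
    using assms(2-5) by (intro has_derivative_add has_derivative_scaleR smooth_on_has_derivative)
  then have "(y has_derivative ?D) (at p)"
    by (rule has_derivative_transform_within_open[OF _ assms(1,2)]) (simp add: assms(6))
  then show ?thesis
    using assms(7) by (simp add: frechet_derivative_at[symmetric] inner_add_left)
qed

text \<open>
  For \<open>m \<bullet> s = - cos \<theta>\<close> and \<open>m \<bullet> t = sin \<theta>\<close> the right-hand sides are the two rows of the linear system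
  characterising mates. Both directions of the theorem rest on this computation.
\<close>

lemma normal_offset_partials:
  assumes "open U" "p \<in> U" "framed_surface U x n s" "smooth_on U l"
    and inv: "basic_invariants U x n s a1 b1 e1 f1 g1 a2 b2 e2 f2 g2"
    and "\<And>q. q \<in> U \<Longrightarrow> y q = x q + l q *\<^sub>R n q" and "n p \<bullet> m = 0"
  shows "partial_u y p \<bullet> m =
      (a1 p + l p * e1 p) * (m \<bullet> s p) + (b1 p + l p * f1 p) * (m \<bullet> frame_t n s p)"
    and "partial_v y p \<bullet> m =
      (a2 p + l p * e2 p) * (m \<bullet> s p) + (b2 p + l p * f2 p) * (m \<bullet> frame_t n s p)"
proof -
  have "smooth_on U x" "smooth_on U n"
    using assms(3) by (auto simp: framed_surface_def)
  note D = normal_offset_derivative[OF assms(1,2) this assms(4,6,7)]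
  have P: "frechet_derivative x (at p) (1,0) = a1 p *\<^sub>R s p + b1 p *\<^sub>R frame_t n s p"
    "frechet_derivative n (at p) (1,0) = e1 p *\<^sub>R s p + f1 p *\<^sub>R frame_t n s p"
    "frechet_derivative x (at p) (0,1) = a2 p *\<^sub>R s p + b2 p *\<^sub>R frame_t n s p"
    "frechet_derivative n (at p) (0,1) = e2 p *\<^sub>R s p + f2 p *\<^sub>R frame_t n s p"
    using inv assms(2) by (auto simp: basic_invariants_def Let_def partial_u_def partial_v_def)
  show "partial_u y p \<bullet> m =
      (a1 p + l p * e1 p) * (m \<bullet> s p) + (b1 p + l p * f1 p) * (m \<bullet> frame_t n s p)"
    and "partial_v y p \<bullet> m =
      (a2 p + l p * e2 p) * (m \<bullet> s p) + (b2 p + l p * f2 p) * (m \<bullet> frame_t n s p)"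
    by (simp_all add: partial_u_def partial_v_def D P inner_add_left inner_commute[of m]
        algebra_simps)
qed

section \<open>Characterisation of Bertrand framed surfaces\<close>

lemma vector_2x2_mult_eq_0_iff:
  fixes a b c d x y :: real
  shows "(vector [vector [a, b], vector [c, d]] :: real^2^2) *v (vector [x, y] :: real^2)
      = (vector [0, 0] :: real^2) \<longleftrightarrow> a * x + b * y = 0 \<and> c * x + d * y = 0"
  by (simp add: vec_eq_iff matrix_vector_mult_def sum_2 forall_2)

theorem theorem3p9:
  fixes U :: "(real \<times> real) set"
    and x n s :: "real \<times> real \<Rightarrow> real^3"
    and a1 b1 e1 f1 g1 a2 b2 e2 f2 g2 :: "real \<times> real \<Rightarrow> real"
  assumes "open U" and "U \<noteq> {}" and "simply_connected U"
    and "framed_surface U x n s"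
    and "basic_invariants U x n s a1 b1 e1 f1 g1 a2 b2 e2 f2 g2"
  shows "Bertrand_framed_surface U Leg_n Leg_t x n s \<longleftrightarrow>
    (\<exists>l \<theta> :: real \<times> real \<Rightarrow> real.
       smooth_on U l \<and> smooth_on U \<theta> \<and> densely_nonzero_on U l \<and>
       (\<forall>p\<in>U.
          (vector [vector [a1 p + l p * e1 p, b1 p + l p * f1 p],
                   vector [a2 p + l p * e2 p, b2 p + l p * f2 p]] :: real^2^2)
          *v (vector [- cos (\<theta> p), sin (\<theta> p)] :: real^2) = (vector [0, 0] :: real^2)))"
  (is "?B \<longleftrightarrow> ?E")
proof -
  have sm: "smooth_on U x" "smooth_on U n" "smooth_on U s"
    and Del: "\<And>p. p \<in> U \<Longrightarrow> (n p, s p) \<in> Delta"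
    using assms(4) by (auto simp: framed_surface_def)
  have smt: "smooth_on U (frame_t n s)"
    unfolding frame_t_def by (rule smooth_on_cross3[OF assms(1) sm(2,3)])
  note offset = normal_offset_partials[OF assms(1) _ assms(4) _ assms(5)]
  show ?thesis
  proof
    assume ?B
    then obtain y m r l where fs: "framed_surface U y m r"
      and l: "smooth_on U l" "densely_nonzero_on U l"
      and y: "\<And>p. p \<in> U \<Longrightarrow> y p = x p + l p *\<^sub>R n p"
      and nt: "\<And>p. p \<in> U \<Longrightarrow> n p = frame_t m r p"
      unfolding Bertrand_framed_surface_def mates_def frame_vector.simps by blast
    have smm: "smooth_on U m" and Dm: "\<And>p. p \<in> U \<Longrightarrow> (m p, r p) \<in> Delta"
      and tang: "\<And>p. p \<in> U \<Longrightarrow> partial_u y p \<bullet> m p = 0" "\<And>p. p \<in> U \<Longrightarrow> partial_v y p \<bullet> m p = 0"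
      using fs by (auto simp: framed_surface_def)
    have mn: "n p \<bullet> m p = 0" and unit: "m p \<bullet> m p = 1" if "p \<in> U" for p
      using Delta_frame[OF Dm[OF that]] nt[OF that] by (auto simp: frame_t_def)
    \<comment> \<open>The angle is measured from \<open>- s\<close>, which produces the signs in the linear system.\<close>
    obtain h where h: "smooth_on U h" "\<And>p. p \<in> U \<Longrightarrow> - (m p \<bullet> s p) = cos (h p)"
      "\<And>p. p \<in> U \<Longrightarrow> m p \<bullet> frame_t n s p = sin (h p)"
    proof (rule smooth_polar_angle[OF assms(1,3), of "\<lambda>p. - (m p \<bullet> s p)" "\<lambda>p. m p \<bullet> frame_t n s p"])
      show "(- (m p \<bullet> s p))\<^sup>2 + (m p \<bullet> frame_t n s p)\<^sup>2 = 1" if "p \<in> U" for p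
        using Delta_coordinates_unit[OF Del[OF that], of "m p"] mn[OF that] unit[OF that]
        by (simp add: frame_t_def inner_commute)
    qed (use assms(1) sm smt smm in \<open>auto intro!: smooth_on_minus smooth_on_inner\<close>)
    show ?E
    proof (rule exI[of _ l], rule exI[of _ h], intro conjI ballI)
      fix p assume p: "p \<in> U"
      have ms: "m p \<bullet> s p = - cos (h p)" "m p \<bullet> frame_t n s p = sin (h p)"
        using h(2,3)[OF p] by simp_all
      show "(vector [vector [a1 p + l p * e1 p, b1 p + l p * f1 p],
                   vector [a2 p + l p * e2 p, b2 p + l p * f2 p]] :: real^2^2)
          *v (vector [- cos (h p), sin (h p)] :: real^2) = (vector [0, 0] :: real^2)"
        unfolding vector_2x2_mult_eq_0_iff
        using offset[OF p l(1) y mn[OF p]] tang[OF p] ms by simp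
    qed (use l h in auto)
  next
    assume ?E
    then obtain l h where l: "smooth_on U l" "densely_nonzero_on U l" and h: "smooth_on U h"
      and M: "\<And>p. p \<in> U \<Longrightarrow> (a1 p + l p * e1 p) * - cos (h p) + (b1 p + l p * f1 p) * sin (h p) = 0"
        "\<And>p. p \<in> U \<Longrightarrow> (a2 p + l p * e2 p) * - cos (h p) + (b2 p + l p * f2 p) * sin (h p) = 0"
      unfolding vector_2x2_mult_eq_0_iff by blast
    define y where "y = (\<lambda>p. x p + l p *\<^sub>R n p)"
    define m where "m = (\<lambda>p. (- cos (h p)) *\<^sub>R s p + sin (h p) *\<^sub>R frame_t n s p)"
    \<comment> \<open>\<open>m\<close> and \<open>r\<close> are chosen with \<open>m \<times> r = (cos\<^sup>2 + sin\<^sup>2) (s \<times> t)\<close>, and \<open>s \<times> t = n\<close>.\<close>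
    define r where "r = (\<lambda>p. (- sin (h p)) *\<^sub>R s p + (- cos (h p)) *\<^sub>R frame_t n s p)"
    have smooth: "smooth_on U y" "smooth_on U m" "smooth_on U r"
      unfolding y_def m_def r_def
      by (intro smooth_on_add smooth_on_scaleR smooth_on_minus smooth_on_cos_sin assms(1) sm smt l h)+
    have frame: "(m p, r p) \<in> Delta" "n p \<bullet> m p = 0" "m p \<bullet> s p = - cos (h p)"
      "m p \<bullet> frame_t n s p = sin (h p)" "frame_t m r p = n p" if p: "p \<in> U" for p
    proof -
      note F = Delta_frame[OF Del[OF p], folded fun_cong[OF frame_t_def[of n s]]]
      have cs: "cos (h p) * cos (h p) + sin (h p) * sin (h p) = 1"
        using sin_cos_squared_add3[of "h p"] by simp
      show "(m p, r p) \<in> Delta"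
        using cs by (simp add: Delta_def norm_eq_1 m_def r_def inner_simps F algebra_simps)
      show "n p \<bullet> m p = 0" "m p \<bullet> s p = - cos (h p)" "m p \<bullet> frame_t n s p = sin (h p)"
        by (simp_all add: m_def inner_simps F)
      have "cross3 (m p) (r p) = n p"
        unfolding m_def r_def cross3_linear_combinations using F(10) cs by simp
      then show "frame_t m r p = n p"
        by (simp add: frame_t_def)
    qed
    have "partial_u y p \<bullet> m p = 0" "partial_v y p \<bullet> m p = 0" if p: "p \<in> U" for p
      using offset[OF p l(1) _ frame(2)[OF p], of y] M[OF p]
      by (simp_all add: y_def frame[OF p])
    then have "framed_surface U y m r"
      using smooth frame(1) by (simp add: framed_surface_def)
    moreover have "mates U Leg_n Leg_t x n s y m r"
      unfolding mates_def frame_vector.simps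
    proof (intro conjI exI[of _ l] ballI)
      show "y p = x p + l p *\<^sub>R n p" "n p = frame_t m r p" if "p \<in> U" for p
        using frame(5)[OF that] by (simp_all add: y_def)
    qed (use assms(4) l calculation in auto)
    ultimately show ?B
      unfolding Bertrand_framed_surface_def by blast
  qed
qed

end
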